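(* The semigroup $T_{\mathbb{S}(I)}(X,\mathcal{P})$ is regular if and only if: (i) $\mathbb{S}(I)$ is regular; and (ii) for each $\alpha\in \mathbb{S}(I)$ and each $i\in I$, if $|i\alpha^{-1}|\geq 2$, then $|X_i|=1$.
   Context: $X$ is a nonempty set (possibly infinite) and $\mathcal{P}=\{X_i : i\in I\}$ is a partition of $X$ into nonempty blocks, with $X_i\cap X_j=\varnothing$ for $i\neq j$. $T(Z)$ denotes the semigroup of all maps $Z\to Z$ under composition. Maps are written on the right and composed from left to right: $x(fg)=(xf)g$; $Af=\{af: a\in A\}$; $i\alpha^{-1}=\{k\in I: k\alpha=i\}$. $T(X,\mathcal{P})$ is the subsemigroup of all $f\in T(X)$ such that for every $i\in I$ there is $j\in I$ with $X_if\subseteq X_j$. For $f\in T(X,\mathcal{P})$ the character $\chi^{(f)}\in T(I)$ is defined by $i\chi^{(f)}=j$ whenever $X_if\subseteq X_j$. $\mathbb{S}(I)$ is an arbitrary subsemigroup of $T(I)$, and $T_{\mathbb{S}(I)}(X,\mathcal{P})=\{f\in T(X,\mathcal{P}): \chi^{(f)}\in \mathbb{S}(I)\}$, a subsemigroup of $T(X,\mathcal{P})$. A semigroup $S$ is regular if for every $a\in S$ there is $b\in S$ with $aba=a$. *)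

theory Defs
  imports "HOL-Library.FuncSet" "HOL-Library.Disjoint_Sets"
begin

text \<open>
  Maps \<open>Z \<rightarrow> Z\<close> are represented by extensional functions, so that equality of representatives
  is equality of maps on \<open>Z\<close>.
\<close>

definition transf :: "'a set \<Rightarrow> ('a \<Rightarrow> 'a) set" where
  "transf Z = Z \<rightarrow>\<^sub>E Z"

text \<open>Maps are composed from left to right: \<open>comp_on Z f g\<close> applies \<open>f\<close> first.\<close>

definition comp_on :: "'a set \<Rightarrow> ('a \<Rightarrow> 'a) \<Rightarrow> ('a \<Rightarrow> 'a) \<Rightarrow> 'a \<Rightarrow> 'a" where
  "comp_on Z f g = compose Z g f"

text \<open>The empty subset counts as a subsemigroup.\<close>

definition subsemigroup :: "('s \<Rightarrow> 's \<Rightarrow> 's) \<Rightarrow> 's set \<Rightarrow> 's set \<Rightarrow> bool" where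
  "subsemigroup m H S \<longleftrightarrow> H \<subseteq> S \<and> (\<forall>a\<in>H. \<forall>b\<in>H. m a b \<in> H)"

definition regular :: "('s \<Rightarrow> 's \<Rightarrow> 's) \<Rightarrow> 's set \<Rightarrow> bool" where
  "regular m S \<longleftrightarrow> (\<forall>a\<in>S. \<exists>b\<in>S. m (m a b) a = a)"

definition indexed_partition :: "'a set \<Rightarrow> 'i set \<Rightarrow> ('i \<Rightarrow> 'a set) \<Rightarrow> bool" where
  "indexed_partition X I P \<longleftrightarrow>
     (\<Union>i\<in>I. P i) = X \<and> (\<forall>i\<in>I. P i \<noteq> {}) \<and> disjoint_family_on P I"

definition transf_part :: "'a set \<Rightarrow> 'i set \<Rightarrow> ('i \<Rightarrow> 'a set) \<Rightarrow> ('a \<Rightarrow> 'a) set" where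
  "transf_part X I P = {f \<in> transf X. \<forall>i\<in>I. \<exists>j\<in>I. f ` P i \<subseteq> P j}"

definition character :: "'i set \<Rightarrow> ('i \<Rightarrow> 'a set) \<Rightarrow> ('a \<Rightarrow> 'a) \<Rightarrow> 'i \<Rightarrow> 'i" where
  "character I P f = (\<lambda>i\<in>I. THE j. j \<in> I \<and> f ` P i \<subseteq> P j)"

definition transf_char ::
    "'a set \<Rightarrow> 'i set \<Rightarrow> ('i \<Rightarrow> 'a set) \<Rightarrow> ('i \<Rightarrow> 'i) set \<Rightarrow> ('a \<Rightarrow> 'a) set" where
  "transf_char X I P S = {f \<in> transf_part X I P. character I P f \<in> S}"

lemma character_eq:
  assumes "indexed_partition X I P" "i \<in> I" "j \<in> I" "f ` P i \<subseteq> P j"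
  shows "character I P f i = j"
proof -
  have "k = j" if k: "k \<in> I" "f ` P i \<subseteq> P k" for k
  proof (rule ccontr)
    assume "k \<noteq> j"
    then have "P k \<inter> P j = {}"
      using assms k by (simp add: indexed_partition_def disjoint_family_on_def)
    moreover have "P i \<noteq> {}"
      using assms(1,2) by (simp add: indexed_partition_def)
    ultimately show False using k assms(4) by blast
  qed
  then have "(THE j. j \<in> I \<and> f ` P i \<subseteq> P j) = j"
    using assms(3,4) by (intro the_equality conjI) blast+
  then show ?thesis
    using assms(2) unfolding character_def by (simp only: restrict_apply if_True)
qed

lemma character_image:
  assumes "indexed_partition X I P" "f \<in> transf_part X I P" "i \<in> I"
  shows "character I P f i \<in> I" "f ` P i \<subseteq> P (character I P f i)"
proof -
  obtain j where j: "j \<in> I" "f ` P i \<subseteq> P j"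
    using assms(2,3) unfolding transf_part_def by blast
  have "character I P f i = j"
    by (rule character_eq[OF assms(1,3) j])
  with j show "character I P f i \<in> I" "f ` P i \<subseteq> P (character I P f i)"
    by (simp_all only:)
qed

lemma character_in_transf:
  assumes "indexed_partition X I P" "f \<in> transf_part X I P"
  shows "character I P f \<in> transf I"
  unfolding transf_def
proof (rule PiE_I)
  show "character I P f i \<in> I" if "i \<in> I" for i
    by (rule character_image(1)[OF assms that])
  show "character I P f i = undefined" if "i \<notin> I" for i
    using that unfolding character_def by (simp only: restrict_apply if_False)
qed

lemma comp_on_transf_part:
  assumes "indexed_partition X I P" "f \<in> transf_part X I P" "g \<in> transf_part X I P"
  shows "comp_on X f g \<in> transf_part X I P"
    and "character I P (comp_on X f g) = comp_on I (character I P f) (character I P g)"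
proof -
  let ?c = "character I P"
  have img: "comp_on X f g ` P i \<subseteq> P (?c g (?c f i))" "?c g (?c f i) \<in> I" if "i \<in> I" for i
  proof -
    note f = character_image[OF assms(1,2) that]
    note g = character_image[OF assms(1,3) f(1)]
    show "?c g (?c f i) \<in> I" by (rule g(1))
    have "P i \<subseteq> X" using assms(1) that by (auto simp: indexed_partition_def)
    then have "comp_on X f g ` P i = g ` f ` P i"
      unfolding comp_on_def compose_def image_image by (intro image_cong) auto
    then show "comp_on X f g ` P i \<subseteq> P (?c g (?c f i))"
      using image_mono[OF f(2), of g] g(2) by (metis subset_trans)
  qed
  have "f \<in> X \<rightarrow>\<^sub>E X" "g \<in> X \<rightarrow>\<^sub>E X"
    using assms(2,3) by (auto simp: transf_part_def transf_def)
  then have "comp_on X f g \<in> transf X"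
    unfolding transf_def comp_on_def compose_def by (intro restrict_PiE[THEN iffD2]) auto
  then show "comp_on X f g \<in> transf_part X I P"
    unfolding transf_part_def using img by blast
  show "?c (comp_on X f g) = comp_on I (?c f) (?c g)"
  proof
    fix i
    show "?c (comp_on X f g) i = comp_on I (?c f) (?c g) i"
    proof (cases "i \<in> I")
      case True
      then have "comp_on I (?c f) (?c g) i = ?c g (?c f i)"
        unfolding comp_on_def compose_def by (simp only: restrict_apply if_True)
      with character_eq[OF assms(1) True img(2)[OF True] img(1)[OF True]]
      show ?thesis by (simp only:)
    next
      case False
      then show ?thesis
        unfolding character_def comp_on_def compose_def by (simp only: restrict_apply if_False)
    qed
  qed
qed

lemma subsemigroup_transf_char:
  assumes "indexed_partition X I P" "subsemigroup (comp_on I) S (transf I)"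
  shows "subsemigroup (comp_on X) (transf_char X I P S) (transf_part X I P)"
  unfolding subsemigroup_def
proof (intro conjI ballI)
  show "transf_char X I P S \<subseteq> transf_part X I P"
    unfolding transf_char_def by blast
next
  fix f g
  assume "f \<in> transf_char X I P S" "g \<in> transf_char X I P S"
  then have fg: "f \<in> transf_part X I P" "g \<in> transf_part X I P"
    and S: "character I P f \<in> S" "character I P g \<in> S"
    unfolding transf_char_def by blast+
  have "comp_on I (character I P f) (character I P g) \<in> S"
    using assms(2) S unfolding subsemigroup_def by blast
  then show "comp_on X f g \<in> transf_char X I P S"
    unfolding transf_char_def mem_Collect_eq comp_on_transf_part(2)[OF assms(1) fg]
    using comp_on_transf_part(1)[OF assms(1) fg] by blast
qed

end

theory Submission
  imports Defs
begin

text \<open>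
  The character is a homomorphism onto the chosen semigroup: every \<open>\<alpha>\<close> is the character of a map
  that is constant on each block, and the constants may be any points \<open>c i\<close> of the blocks
  \<open>P (\<alpha> i)\<close> (\<open>blockwise_constant_lift\<close>). Both conditions follow from regularity by
  feeding such lifts to it. Regularity passes to homomorphic images. And if \<open>\<alpha>\<close> sends two blocks
  to one block with distinct points \<open>a\<close>, \<open>b\<close>, send one of them to \<open>a\<close> and the other to \<open>b\<close>.
  A pseudo-inverse \<open>g\<close> of this \<open>f\<close> keeps \<open>a\<close> and \<open>b\<close> in a common block, on which \<open>f\<close> is
  constant, so \<open>f\<close> cannot recover both.

  Conversely, let \<open>\<beta>\<close> be a pseudo-inverse of the character \<open>\<alpha>\<close> of \<open>f\<close>. A pseudo-inverse of \<open>f\<close> with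
  character \<open>\<beta>\<close> exists as soon as every point \<open>y\<close> in the range of \<open>f\<close>, say \<open>y \<in> P j\<close>,
  has a preimage in the one block \<open>P (\<beta> j)\<close>. The size condition provides it
  (\<open>preimage_in_chosen_block\<close>): either \<open>\<beta> j\<close> is the only index that \<open>\<alpha>\<close> sends to \<open>j\<close>, or \<open>P j\<close> is
  the single point \<open>y\<close>.
\<close>

lemma infinite_or_card_ge_2_iff:
  "infinite A \<or> card A \<ge> 2 \<longleftrightarrow> (\<exists>k\<in>A. \<exists>l\<in>A. k \<noteq> l)"
proof (cases "finite A")
  case True
  then show ?thesis
    using card_le_Suc0_iff_eq[OF True] by (auto simp: not_less_eq_eq numeral_2_eq_2)
next
  case False
  then have "A \<noteq> {}" and "infinite (A - {k})" for k by auto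
  then show ?thesis by (metis DiffE False all_not_in_conv finite.emptyI insertCI)
qed

lemma comp_on_pseudo_inverse_iff:
  assumes "f \<in> transf Z" "g \<in> transf Z"
  shows "comp_on Z (comp_on Z f g) f = f \<longleftrightarrow> (\<forall>x\<in>Z. f (g (f x)) = f x)"
proof -
  have "comp_on Z (comp_on Z f g) f x = (if x \<in> Z then f (g (f x)) else undefined)" for x
    by (simp add: comp_on_def compose_def)
  moreover have "f x = undefined" if "x \<notin> Z" for x
    using assms(1) that by (auto simp: transf_def)
  ultimately show ?thesis by (auto simp: fun_eq_iff)
qed

lemma indexed_partition_block_unique:
  assumes "indexed_partition X I P" "i \<in> I" "j \<in> I" "x \<in> P i" "x \<in> P j"
  shows "i = j"
  using assms unfolding indexed_partition_def disjoint_family_on_def by blast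

lemma restrict_with_character:
  assumes part: "indexed_partition X I P" and "\<alpha> \<in> transf I"
    and h: "\<And>i x. i \<in> I \<Longrightarrow> x \<in> P i \<Longrightarrow> h x \<in> P (\<alpha> i)"
  shows "restrict h X \<in> transf_part X I P" "character I P (restrict h X) = \<alpha>"
proof -
  have \<alpha>: "\<alpha> i \<in> I" if "i \<in> I" for i
    using assms(2) that by (auto simp: transf_def)
  have cover: "(\<Union>i\<in>I. P i) = X"
    using part by (simp add: indexed_partition_def)
  have img: "restrict h X ` P i \<subseteq> P (\<alpha> i)" if "i \<in> I" for i
    using h that cover by auto
  have "restrict h X \<in> transf X"
    using h \<alpha> cover by (fastforce simp: transf_def)
  then show "restrict h X \<in> transf_part X I P"
    unfolding transf_part_def using img \<alpha> by blast
  show "character I P (restrict h X) = \<alpha>"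
  proof
    fix i
    show "character I P (restrict h X) i = \<alpha> i"
    proof (cases "i \<in> I")
      case True
      then show ?thesis using character_eq[OF part True \<alpha> img] by blast
    next
      case False
      then show ?thesis using assms(2) by (auto simp: character_def transf_def)
    qed
  qed
qed

text \<open>These lifts are the test maps to which regularity is applied.\<close>

lemma blockwise_constant_lift:
  assumes part: "indexed_partition X I P" and "\<alpha> \<in> transf I"
    and c: "\<And>i. i \<in> I \<Longrightarrow> c i \<in> P (\<alpha> i)"
  obtains f where "f \<in> transf_part X I P" "character I P f = \<alpha>"
    "\<And>i x. i \<in> I \<Longrightarrow> x \<in> P i \<Longrightarrow> f x = c i"
proof -
  define h where "h x = c (THE i. i \<in> I \<and> x \<in> P i)" for x
  have h: "h x = c i" if "i \<in> I" "x \<in> P i" for i x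
  proof -
    have "(THE i. i \<in> I \<and> x \<in> P i) = i"
      using that indexed_partition_block_unique[OF part] by (intro the_equality) blast+
    then show ?thesis by (simp add: h_def)
  qed
  have "restrict h X \<in> transf_part X I P" "character I P (restrict h X) = \<alpha>"
    using restrict_with_character[OF part assms(2), of h] h c by auto
  moreover have "restrict h X x = c i" if "i \<in> I" "x \<in> P i" for i x
    using part that h by (auto simp: indexed_partition_def)
  ultimately show thesis using that by blast
qed

lemma regular_imp_pseudo_inverse_in_transf_char:
  assumes "regular (comp_on X) (transf_char X I P S)"
    and f: "f \<in> transf_part X I P" "character I P f \<in> S"
  obtains g where "g \<in> transf_part X I P" "character I P g \<in> S"
    "comp_on X (comp_on X f g) f = f"
  using assms unfolding regular_def transf_char_def by blast

lemma regular_characters: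
  assumes part: "indexed_partition X I P" and S: "S \<subseteq> transf I"
    and reg: "regular (comp_on X) (transf_char X I P S)"
  shows "regular (comp_on I) S"
  unfolding regular_def
proof
  fix \<alpha> assume "\<alpha> \<in> S"
  then have \<alpha>: "\<alpha> \<in> transf I" using S by blast
  have "(SOME x. x \<in> P (\<alpha> i)) \<in> P (\<alpha> i)" if "i \<in> I" for i
    using part \<alpha> that by (auto simp: some_in_eq indexed_partition_def transf_def)
  then obtain f where f: "f \<in> transf_part X I P" "character I P f = \<alpha>"
    using blockwise_constant_lift[OF part \<alpha>, of "\<lambda>i. SOME x. x \<in> P (\<alpha> i)"] by blast
  then obtain g where g: "g \<in> transf_part X I P" "character I P g \<in> S"
    and fgf: "comp_on X (comp_on X f g) f = f"
    using regular_imp_pseudo_inverse_in_transf_char[OF reg] \<open>\<alpha> \<in> S\<close> by metis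
  have "comp_on I (comp_on I \<alpha> (character I P g)) \<alpha> = \<alpha>"
    using comp_on_transf_part[OF part] f g fgf by metis
  then show "\<exists>\<beta>\<in>S. comp_on I (comp_on I \<alpha> \<beta>) \<alpha> = \<alpha>" using g by blast
qed

text \<open>
  The blocks with indices \<open>k\<close> and \<open>l\<close> are sent to \<open>a\<close> and \<open>b\<close>, so a pseudo-inverse must keep the
  two points apart even after \<open>f\<close>; but it takes both into one block, which \<open>f\<close> collapses.
\<close>

lemma regular_imp_merged_block_subsingleton:
  assumes part: "indexed_partition X I P" and S: "S \<subseteq> transf I"
    and reg: "regular (comp_on X) (transf_char X I P S)"
    and "\<alpha> \<in> S" and kl: "k \<in> I" "l \<in> I" "k \<noteq> l" "\<alpha> k = \<alpha> l"
    and ab: "a \<in> P (\<alpha> k)" "b \<in> P (\<alpha> k)"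
  shows "a = b"
proof -
  have \<alpha>: "\<alpha> \<in> transf I" using S \<open>\<alpha> \<in> S\<close> by blast
  define c where "c i = (if i = k then a else if i = l then b else SOME x. x \<in> P (\<alpha> i))" for i
  have "c i \<in> P (\<alpha> i)" if "i \<in> I" for i
    using part \<alpha> that kl ab by (auto simp: c_def some_in_eq indexed_partition_def transf_def)
  then obtain f where f: "f \<in> transf_part X I P" "character I P f = \<alpha>"
    and fc: "\<And>i x. i \<in> I \<Longrightarrow> x \<in> P i \<Longrightarrow> f x = c i"
    using blockwise_constant_lift[OF part \<alpha>, of c] by blast
  then obtain g where g: "g \<in> transf_part X I P"
    and fgf: "comp_on X (comp_on X f g) f = f"
    using regular_imp_pseudo_inverse_in_transf_char[OF reg] \<open>\<alpha> \<in> S\<close> by metis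
  have fix_f: "f (g (f x)) = f x" if "x \<in> X" for x
    using comp_on_pseudo_inverse_iff[of f X g] f g fgf that by (auto simp: transf_part_def)
  have fix_c: "f (g (c i)) = c i" if i: "i \<in> I" for i
  proof -
    obtain x where "x \<in> P i" "x \<in> X" using part i unfolding indexed_partition_def by blast
    then show ?thesis using fix_f fc i by metis
  qed
  have "\<alpha> k \<in> I" using \<alpha> kl by (auto simp: transf_def)
  then obtain m where m: "m \<in> I" "g ` P (\<alpha> k) \<subseteq> P m"
    using character_image[OF part g] by blast
  have "a = f (g a)" using fix_c[of k] kl by (simp add: c_def)
  also have "\<dots> = c m" using fc m ab by blast
  also have "\<dots> = f (g b)" using fc m ab by (metis image_subset_iff)
  also have "\<dots> = b" using fix_c[of l] kl by (simp add: c_def)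
  finally show ?thesis .
qed

text \<open>
  The point \<open>y = f x\<close> lies in \<open>P j\<close> for \<open>j = \<alpha> i\<close>, and \<open>\<alpha>\<close> sends both \<open>i\<close> and \<open>\<beta> j\<close> to \<open>j\<close>.
  If they agree, \<open>x\<close> itself serves; if not, \<open>P j\<close> is merged, hence equal to \<open>{y}\<close>, and every point
  of \<open>P (\<beta> j)\<close> is a preimage of \<open>y\<close>.
\<close>

lemma preimage_in_chosen_block:
  assumes part: "indexed_partition X I P" and f: "f \<in> transf_part X I P"
    and \<beta>: "\<beta> \<in> transf I"
    and inv: "\<And>i. i \<in> I \<Longrightarrow> character I P f (\<beta> (character I P f i)) = character I P f i"
    and single: "\<And>k l a b. \<lbrakk>k \<in> I; l \<in> I; k \<noteq> l; character I P f k = character I P f l;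
      a \<in> P (character I P f k); b \<in> P (character I P f k)\<rbrakk> \<Longrightarrow> a = b"
    and "j \<in> I" "x \<in> X" "f x \<in> P j"
  shows "\<exists>z\<in>P (\<beta> j). f z = f x"
proof -
  let ?\<alpha> = "character I P f"
  obtain i where i: "i \<in> I" "x \<in> P i"
    using part \<open>x \<in> X\<close> by (auto simp: indexed_partition_def)
  note im = character_image[OF part f]
  have j: "?\<alpha> i = j"
    using indexed_partition_block_unique[OF part] im[OF i(1)] i assms by blast
  have \<beta>j: "\<beta> j \<in> I" "?\<alpha> (\<beta> j) = j"
    using \<beta> \<open>j \<in> I\<close> inv[OF i(1)] j by (auto simp: transf_def)
  show ?thesis
  proof (cases "\<beta> j = i")
    case True
    then show ?thesis using i by blast
  next
    case False
    obtain z where z: "z \<in> P (\<beta> j)"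
      using part \<beta>j(1) unfolding indexed_partition_def by blast
    then have "f z \<in> P j" using im(2)[OF \<beta>j(1)] \<beta>j(2) by auto
    then have "f z = f x"
      using single[of "\<beta> j" i "f z" "f x"] \<beta>j i(1) False j \<open>f x \<in> P j\<close> by simp
    then show ?thesis using z by blast
  qed
qed

lemma regular_transf_char:
  assumes part: "indexed_partition X I P" and S: "S \<subseteq> transf I"
    and reg: "regular (comp_on I) S"
    and single: "\<And>\<alpha> k l a b. \<lbrakk>\<alpha> \<in> S; k \<in> I; l \<in> I; k \<noteq> l; \<alpha> k = \<alpha> l;
      a \<in> P (\<alpha> k); b \<in> P (\<alpha> k)\<rbrakk> \<Longrightarrow> a = b"
  shows "regular (comp_on X) (transf_char X I P S)"
  unfolding regular_def
proof
  fix f assume "f \<in> transf_char X I P S"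
  then have f: "f \<in> transf_part X I P" and fS: "character I P f \<in> S"
    by (auto simp: transf_char_def)
  let ?\<alpha> = "character I P f"
  obtain \<beta> where "\<beta> \<in> S" and aba: "comp_on I (comp_on I ?\<alpha> \<beta>) ?\<alpha> = ?\<alpha>"
    using reg fS unfolding regular_def by blast
  then have \<beta>: "\<beta> \<in> transf I" using S by blast
  have inv: "?\<alpha> (\<beta> (?\<alpha> i)) = ?\<alpha> i" if "i \<in> I" for i
    using comp_on_pseudo_inverse_iff[of ?\<alpha> I \<beta>] aba S fS \<beta> that by blast
  (* Off the range of f the value only has to lie in the block prescribed by \<beta>. *)
  have choice: "\<exists>z. \<forall>j\<in>I. y \<in> P j \<longrightarrow> z \<in> P (\<beta> j) \<and> (y \<in> f ` X \<longrightarrow> f z = y)" for y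
  proof (cases "\<exists>j\<in>I. y \<in> P j")
    case True
    then obtain j where j: "j \<in> I" "y \<in> P j" by blast
    have "\<exists>z\<in>P (\<beta> j). y \<in> f ` X \<longrightarrow> f z = y"
    proof (cases "y \<in> f ` X")
      case True
      then obtain x where x: "x \<in> X" "y = f x" by blast
      have "\<exists>z\<in>P (\<beta> j). f z = f x"
        by (rule preimage_in_chosen_block[OF part f \<beta> inv]) (use single[OF fS] j x in auto)
      then show ?thesis using x by blast
    next
      case False
      have "\<beta> j \<in> I" using \<beta> j by (auto simp: transf_def)
      then show ?thesis using part False unfolding indexed_partition_def by blast
    qed
    then show ?thesis using j indexed_partition_block_unique[OF part] by metis
  next
    case False
    then show ?thesis by blast
  qed
  then obtain h where h: "\<And>y j. j \<in> I \<Longrightarrow> y \<in> P j \<Longrightarrow>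
      h y \<in> P (\<beta> j) \<and> (y \<in> f ` X \<longrightarrow> f (h y) = y)"
    by metis
  let ?g = "restrict h X"
  have g: "?g \<in> transf_part X I P" "character I P ?g = \<beta>"
    using restrict_with_character[OF part \<beta>, of h] h by auto
  have "f (?g (f x)) = f x" if x: "x \<in> X" for x
  proof -
    have fx: "f x \<in> X" using f x by (auto simp: transf_part_def transf_def)
    then obtain j where "j \<in> I" "f x \<in> P j"
      using part by (auto simp: indexed_partition_def)
    then show ?thesis using h fx x by simp
  qed
  then have "comp_on X (comp_on X f ?g) f = f"
    using comp_on_pseudo_inverse_iff[of f X ?g] f g by (auto simp: transf_part_def)
  moreover have "?g \<in> transf_char X I P S"
    using g \<open>\<beta> \<in> S\<close> by (simp add: transf_char_def)
  ultimately show "\<exists>g\<in>transf_char X I P S. comp_on X (comp_on X f g) f = f" by blast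
qed

theorem theorem3p5:
  fixes X :: "'a set" and I :: "'i set" and P :: "'i \<Rightarrow> 'a set" and S :: "('i \<Rightarrow> 'i) set"
  assumes "X \<noteq> {}"
    and "indexed_partition X I P"
    and "subsemigroup (comp_on I) S (transf I)"
  shows "regular (comp_on X) (transf_char X I P S) \<longleftrightarrow>
    regular (comp_on I) S \<and>
    (\<forall>\<alpha>\<in>S. \<forall>i\<in>I.
       infinite {k \<in> I. \<alpha> k = i} \<or> card {k \<in> I. \<alpha> k = i} \<ge> 2 \<longrightarrow> card (P i) = 1)"
proof -
  note part = assms(2)
  have S: "S \<subseteq> transf I" using assms(3) by (simp add: subsemigroup_def)
  show ?thesis
    unfolding infinite_or_card_ge_2_iff
  proof (intro iffI conjI ballI impI)
    assume reg: "regular (comp_on X) (transf_char X I P S)"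
    then show "regular (comp_on I) S" by (rule regular_characters[OF part S])
    fix \<alpha> i assume "\<alpha> \<in> S" "i \<in> I" "\<exists>k\<in>{k \<in> I. \<alpha> k = i}. \<exists>l\<in>{k \<in> I. \<alpha> k = i}. k \<noteq> l"
    then obtain k l where kl: "k \<in> I" "l \<in> I" "k \<noteq> l" "\<alpha> k = \<alpha> l" and i: "\<alpha> k = i" by auto
    obtain a where a: "a \<in> P i"
      using part \<open>i \<in> I\<close> unfolding indexed_partition_def by blast
    have "P i = {a}"
      using regular_imp_merged_block_subsingleton[OF part S reg \<open>\<alpha> \<in> S\<close> kl] a i by blast
    then show "card (P i) = 1" by simp
  next
    assume R: "regular (comp_on I) S \<and> (\<forall>\<alpha>\<in>S. \<forall>i\<in>I.
      (\<exists>k\<in>{k \<in> I. \<alpha> k = i}. \<exists>l\<in>{k \<in> I. \<alpha> k = i}. k \<noteq> l) \<longrightarrow> card (P i) = 1)"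
    show "regular (comp_on X) (transf_char X I P S)"
    proof (rule regular_transf_char[OF part S])
      show "regular (comp_on I) S" using R by blast
      fix \<alpha> k l a b
      assume *: "\<alpha> \<in> S" "k \<in> I" "l \<in> I" "k \<noteq> l" "\<alpha> k = \<alpha> l" "a \<in> P (\<alpha> k)" "b \<in> P (\<alpha> k)"
      have "\<alpha> k \<in> I" using S * by (auto simp: transf_def)
      moreover have "\<exists>k'\<in>{k' \<in> I. \<alpha> k' = \<alpha> k}. \<exists>l'\<in>{k' \<in> I. \<alpha> k' = \<alpha> k}. k' \<noteq> l'"
        using * by (intro bexI[of _ k] bexI[of _ l]) auto
      ultimately have "card (P (\<alpha> k)) = 1" using R \<open>\<alpha> \<in> S\<close> by blast
      then show "a = b" using * by (metis card_1_singletonE singletonD)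
    qed
  qed
qed

end
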